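(* Let $p\ge 3$ and let $A$ be a symmetric positive definite real $p\times p$ matrix. Let $Y=(Y_1,\dots,Y_p)$ have independent components $Y_i\sim\mathrm{Poisson}(\theta_i)$, with $\theta=(\theta_1,\dots,\theta_p)\in(0,\infty)^p$ unknown. Consider the loss function $L(\theta,\delta)=(\delta-\theta)^{t}A(\delta-\theta)$. Then $\delta_0(Y)=Y$ is inadmissible under $L$. Moreover, let $M$ be the inverse of the smallest eigenvalue of $A$, and for $y=(y_1,\dots,y_p)\in\{0,1,2,\dots\}^p$ put $N(y)=\sum_{i=1}^p I\{y_i\ge 1\}$, and $B(y)=\sum_{i=1}^p T(y_i)T(y_i+1)$, where $T(0)=0$ and $T(k)=\sum_{j=1}^{k}1/j$ for $k\ge 1$. Let $d:\{0,1,2,\dots\}^p\to\mathbb{R}$ be any function, not identically zero, that is nondecreasing in each argument and satisfies $$0\le d(y)\le \frac{2}{M}\{N(y)-2\}_{+}\quad\text{for all } y.$$ Let $\psi(y)=(\psi_1(y),\dots,\psi_p(y))^{t}$ with $$\psi_i(y)=\frac{d(y)}{B(y)}\,T(y_i),\qquad i=1,\dots,p .$$ Then $\delta_0(Y)=Y$ is dominated under $L$ by the estimator $\delta(Y)=Y-A^{-1}\psi(Y)$.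
   Context: The risk of an estimator $\delta$ is $R(\delta,\theta)=\mathrm{E}_\theta L(\theta,\delta(Y))$. An estimator $\delta$ dominates $\delta_0$ if $R(\delta,\theta)\le R(\delta_0,\theta)$ for all $\theta\in(0,\infty)^p$, with strict inequality for at least one $\theta$; an estimator is inadmissible if some estimator dominates it. $I\{\cdot\}$ is the indicator function and $a_+=\max(a,0)$. When $y=0$ one has $B(y)=0$ and $d(y)=0$, and $\psi_i(y)$ is then taken to be $0$. *)

theory Defs
  imports "HOL-Probability.Probability"
begin

text \<open>
  Vectors and matrices are indexed by a finite type \<open>'n\<close>, so that the dimension \<open>p\<close> is
  \<open>CARD('n)\<close>. Observations are functions \<open>'n \<Rightarrow> nat\<close>; an estimator is an arbitrary map from
  observations to \<open>real^'n\<close>.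
\<close>

definition symmetric_positive_definite :: "real^'n^'n \<Rightarrow> bool" where
  "symmetric_positive_definite A \<longleftrightarrow>
     transpose A = A \<and> (\<forall>x. x \<noteq> 0 \<longrightarrow> x \<bullet> (A *v x) > 0)"

definition is_eigenvalue :: "real^'n^'n \<Rightarrow> real \<Rightarrow> bool" where
  "is_eigenvalue A c \<longleftrightarrow> (\<exists>v. v \<noteq> 0 \<and> A *v v = c *\<^sub>R v)"

text \<open>\<open>LEAST\<close> is meaningful only if the real spectrum has a least element, as it does for symmetric \<open>A\<close>.\<close>

definition smallest_eigenvalue :: "real^'n^'n \<Rightarrow> real" where
  "smallest_eigenvalue A = (LEAST c. is_eigenvalue A c)"

text \<open>The joint law of independent \<open>Y i \<sim> Poisson (\<theta> $ i)\<close>, used for \<open>\<theta> $ i > 0\<close>.\<close>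

definition poisson_vec_pmf :: "real^'n \<Rightarrow> ('n::finite \<Rightarrow> nat) pmf" where
  "poisson_vec_pmf \<theta> = Pi_pmf UNIV 0 (\<lambda>i. poisson_pmf (\<theta> $ i))"

definition quadratic_loss :: "real^'n^'n \<Rightarrow> real^'n \<Rightarrow> real^'n \<Rightarrow> real" where
  "quadratic_loss A \<theta> a = (a - \<theta>) \<bullet> (A *v (a - \<theta>))"

text \<open>
  The risk takes values in \<open>[0, \<infinity>]\<close>, so that estimators with infinite risk are treated correctly
  (a Bochner integral would give them risk \<open>0\<close>). The loss is meant to be nonnegative.
\<close>

definition risk ::
  "(real^'n \<Rightarrow> real^'n \<Rightarrow> real) \<Rightarrow> (('n::finite \<Rightarrow> nat) \<Rightarrow> real^'n) \<Rightarrow> real^'n \<Rightarrow> ennreal" where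
  "risk L \<delta> \<theta> = (\<integral>\<^sup>+ y. ennreal (L \<theta> (\<delta> y)) \<partial>measure_pmf (poisson_vec_pmf \<theta>))"

definition parameter_space :: "(real^'n) set" where
  "parameter_space = {\<theta>. \<forall>i. \<theta> $ i > 0}"

definition dominates ::
  "(real^'n \<Rightarrow> real^'n \<Rightarrow> real) \<Rightarrow> (('n::finite \<Rightarrow> nat) \<Rightarrow> real^'n) \<Rightarrow> (('n \<Rightarrow> nat) \<Rightarrow> real^'n) \<Rightarrow> bool"
  where
  "dominates L \<delta> \<delta>' \<longleftrightarrow>
     (\<forall>\<theta>\<in>parameter_space. risk L \<delta> \<theta> \<le> risk L \<delta>' \<theta>) \<and>
     (\<exists>\<theta>\<in>parameter_space. risk L \<delta> \<theta> < risk L \<delta>' \<theta>)"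

definition inadmissible ::
  "(real^'n \<Rightarrow> real^'n \<Rightarrow> real) \<Rightarrow> (('n::finite \<Rightarrow> nat) \<Rightarrow> real^'n) \<Rightarrow> bool" where
  "inadmissible L \<delta> \<longleftrightarrow> (\<exists>\<delta>'. dominates L \<delta>' \<delta>)"

definition usual_estimator :: "('n::finite \<Rightarrow> nat) \<Rightarrow> real^'n" where
  "usual_estimator y = (\<chi> i. real (y i))"

definition num_positive :: "('n::finite \<Rightarrow> nat) \<Rightarrow> nat" where
  "num_positive y = (\<Sum>i\<in>UNIV. of_bool (y i \<ge> 1))"

text \<open>The function \<open>T\<close> of the mathematical text is the harmonic number \<open>harm\<close>, with \<open>harm 0 = 0\<close>.\<close>

definition B_fun :: "('n::finite \<Rightarrow> nat) \<Rightarrow> real" where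
  "B_fun y = (\<Sum>i\<in>UNIV. harm (y i) * harm (y i + 1))"

definition nondecreasing_each :: "(('n \<Rightarrow> nat) \<Rightarrow> real) \<Rightarrow> bool" where
  "nondecreasing_each d \<longleftrightarrow> (\<forall>y i k. y i \<le> k \<longrightarrow> d y \<le> d (y(i := k)))"

text \<open>At \<open>y = 0\<close>, where \<open>B_fun y = 0\<close>, the value is \<open>0\<close> because \<open>x / 0 = 0\<close>.\<close>

definition psi :: "(('n::finite \<Rightarrow> nat) \<Rightarrow> real) \<Rightarrow> ('n \<Rightarrow> nat) \<Rightarrow> real^'n" where
  "psi d y = (\<chi> i. d y / B_fun y * harm (y i))"

end

theory Submission
  imports Defs
begin

text \<open>
  Write \<open>\<lambda> = 1 / M\<close> for the smallest eigenvalue of \<open>A\<close>, \<open>e\<^sub>i\<close> for the \<open>i\<close>-th unit vector and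
  \<open>T\<close> for \<open>harm\<close>. Replacing \<open>Y\<close> by \<open>Y - A\<inverse> \<psi>(Y)\<close> lowers the loss by
  \<open>2 (Y - \<theta>) \<bullet> \<psi>(Y) - \<psi>(Y) \<bullet> A\<inverse> \<psi>(Y)\<close>, because \<open>A\<close> cancels in the cross term. The quadratic
  term is at most \<open>\<psi>(Y) \<bullet> \<psi>(Y) / \<lambda>\<close> (\<open>inverse_form_le\<close>). The parameter is removed from the cross
  term by the Poisson counterpart of Stein's identity,
  \<open>E[\<theta>\<^sub>i f(Y)] = E[Y\<^sub>i f(Y - e\<^sub>i)]\<close> (\<open>poisson_vec_shift\<close>). Domination therefore follows from an
  inequality that does not involve \<open>\<theta>\<close>,
  \<open>\<psi>(y) \<bullet> \<psi>(y) / \<lambda> \<le> 2 (\<Sum>i. y\<^sub>i (\<psi>\<^sub>i(y) - \<psi>\<^sub>i(y - e\<^sub>i)))\<close> for every \<open>y\<close>, strict where \<open>d(y) > 0\<close>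
  (\<open>psi_correction_inequality\<close>). Every \<open>y\<close> has positive probability, so one strict point makes
  the risk strictly smaller at every \<open>\<theta>\<close>.

  For the pointwise inequality at a \<open>y\<close> with \<open>d(y) > 0\<close>, and therefore \<open>N > 2\<close>, monotonicity
  of \<open>d\<close> allows \<open>d(y - e\<^sub>i)\<close> to be replaced by \<open>d(y)\<close>.
  Put \<open>z\<^sub>i = T(y\<^sub>i) T(y\<^sub>i + 1)\<close>, so that \<open>B = \<Sum>i. z\<^sub>i\<close>. A coordinate with \<open>y\<^sub>i \<ge> 1\<close> contributes
  \<open>d/B\<close> from the increment \<open>1/y\<^sub>i\<close> of \<open>T\<close>, and loses from the change of \<open>B\<close> at most
  \<open>(d/B) (2 - 1/(y\<^sub>i + 1)) z\<^sub>i / B\<close>. These losses sum to less than \<open>2 d/B\<close>, so the right-hand side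
  exceeds \<open>2 (N - 2) d/B\<close>, while \<open>\<Sum>i. T(y\<^sub>i)\<^sup>2 \<le> B\<close> and the bound on \<open>d\<close> keep the left-hand side
  at most \<open>d\<^sup>2 / (\<lambda> B) \<le> 2 (N - 2) d/B\<close>. Inadmissibility is the case in which \<open>d\<close> equals its upper
  bound; that function is not zero because \<open>N\<close> takes the value \<open>p \<ge> 3\<close>.
\<close>

section \<open>Spectral bounds\<close>

lemma symmetric_dot_swap:
  fixes A :: "real^'n^'n"
  assumes "transpose A = A"
  shows "x \<bullet> (A *v y) = (A *v x) \<bullet> y"
  using assms by (metis dot_lmul_matrix transpose_matrix_vector)

text \<open>
  The Rayleigh quotient attains its minimum \<open>c\<close> on the compact unit sphere, at \<open>v\<close> say. The form
  \<open>x \<bullet> (A *v x) - c * (x \<bullet> x)\<close> is then nonnegative and vanishes at \<open>v\<close>, so its first variation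
  at \<open>v\<close> in the direction of the residual \<open>A *v v - c *\<^sub>R v\<close> has to vanish; that variation is
  twice the squared norm of the residual.
\<close>
lemma Rayleigh_minimum_exists:
  fixes A :: "real^'n^'n"
  assumes sym: "transpose A = A"
  obtains c where "is_eigenvalue A c" "\<And>x. c * (x \<bullet> x) \<le> x \<bullet> (A *v x)"
proof -
  have cont: "continuous_on (sphere 0 1) (\<lambda>x. x \<bullet> (A *v x))"
    by (intro continuous_intros linear_continuous_on matrix_vector_mul_bounded_linear)
  have "axis undefined 1 \<in> sphere (0::real^'n) 1" by simp
  hence ne: "sphere (0::real^'n) 1 \<noteq> {}" by blast
  from continuous_attains_inf[OF compact_sphere ne cont]
  obtain v where v: "norm v = 1" "\<And>x. norm x = 1 \<Longrightarrow> v \<bullet> (A *v v) \<le> x \<bullet> (A *v x)"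
    by auto
  define c where "c = v \<bullet> (A *v v)"
  have vv: "v \<bullet> v = 1" using v(1) by (simp add: dot_square_norm)
  have low: "c * (x \<bullet> x) \<le> x \<bullet> (A *v x)" for x
  proof (cases "x = 0")
    case False
    define u where "u = (1 / norm x) *\<^sub>R x"
    have x: "x = norm x *\<^sub>R u" using False by (simp add: u_def)
    have "norm u = 1" using False by (simp add: u_def)
    hence "c \<le> u \<bullet> (A *v u)" using v(2) by (simp add: c_def)
    hence "(norm x)\<^sup>2 * c \<le> (norm x)\<^sup>2 * (u \<bullet> (A *v u))" by (intro mult_left_mono) auto
    also have "\<dots> = x \<bullet> (A *v x)"
      using False by (simp add: u_def matrix_vector_mult_scaleR power2_eq_square)
    finally show ?thesis by (simp add: dot_square_norm mult.commute)
  qed simp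
  define r where "r = A *v v - c *\<^sub>R v"
  have key: "0 \<le> 2 * t * (r \<bullet> r) + t\<^sup>2 * (r \<bullet> (A *v r) - c * (r \<bullet> r))" for t
  proof -
    have rv: "r \<bullet> (A *v v) = r \<bullet> r + c * (r \<bullet> v)"
      by (subst (3) r_def) (simp add: inner_diff_right)
    moreover have "v \<bullet> (A *v r) = r \<bullet> r + c * (r \<bullet> v)"
      using symmetric_dot_swap[OF sym, of v r] rv by (simp add: inner_commute)
    ultimately have "(v + t *\<^sub>R r) \<bullet> (A *v (v + t *\<^sub>R r)) - c * ((v + t *\<^sub>R r) \<bullet> (v + t *\<^sub>R r))
      = 2 * t * (r \<bullet> r) + t\<^sup>2 * (r \<bullet> (A *v r) - c * (r \<bullet> r))"
      by (simp add: matrix_vector_right_distrib matrix_vector_mult_scaleR inner_add_left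
          inner_add_right vv c_def[symmetric] inner_commute[of v r] power2_eq_square algebra_simps)
    thus ?thesis using low[of "v + t *\<^sub>R r"] by linarith
  qed
  have "r = 0"
  proof (rule ccontr)
    assume "r \<noteq> 0"
    define a where "a = r \<bullet> r"
    define q where "q = r \<bullet> (A *v r) - c * (r \<bullet> r)"
    have a: "a > 0" using \<open>r \<noteq> 0\<close> by (simp add: a_def)
    have q: "q \<ge> 0" using low[of r] by (simp add: q_def)
    \<comment> \<open>The quadratic in \<open>t\<close> is smallest at \<open>- a / q\<close>; with \<open>q + 1\<close> for \<open>q\<close> it is still
      negative there, and the case \<open>q = 0\<close> is covered.\<close>
    have "0 \<le> 2 * (- a / (q + 1)) * a + (- a / (q + 1))\<^sup>2 * q"
      using key[of "- a / (q + 1)"] by (simp add: a_def q_def)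
    also have "\<dots> = - (a\<^sup>2 * (q + 2) / (q + 1)\<^sup>2)"
      using q by (simp add: field_simps power2_eq_square add_nonneg_eq_0_iff)
    also have "\<dots> < 0" using a q by simp
    finally show False by simp
  qed
  hence "is_eigenvalue A c"
    unfolding is_eigenvalue_def r_def using vv by (intro exI[of _ v]) auto
  thus thesis using low that by blast
qed

text \<open>
  The minimum of the Rayleigh quotient is an eigenvalue, and it is below every other one by
  evaluation at an eigenvector; hence the \<open>LEAST\<close> in the definition is attained.
\<close>
lemma smallest_eigenvalue_symmetric:
  fixes A :: "real^'n^'n"
  assumes sym: "transpose A = A"
  shows "is_eigenvalue A (smallest_eigenvalue A)"
    and "smallest_eigenvalue A * (x \<bullet> x) \<le> x \<bullet> (A *v x)"
proof -
  obtain c where c: "is_eigenvalue A c" "\<And>x. c * (x \<bullet> x) \<le> x \<bullet> (A *v x)"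
    using Rayleigh_minimum_exists[OF sym] by blast
  have "smallest_eigenvalue A = c"
    unfolding smallest_eigenvalue_def
  proof (rule Least_equality)
    fix e assume "is_eigenvalue A e"
    then obtain v where v: "v \<noteq> 0" "A *v v = e *\<^sub>R v" by (auto simp: is_eigenvalue_def)
    have "c * (v \<bullet> v) \<le> e * (v \<bullet> v)" using c(2)[of v] v(2) by simp
    thus "c \<le> e" using v(1) by simp
  qed (fact c(1))
  thus "is_eigenvalue A (smallest_eigenvalue A)"
    "smallest_eigenvalue A * (x \<bullet> x) \<le> x \<bullet> (A *v x)" using c by auto
qed

lemma smallest_eigenvalue_pos:
  assumes "symmetric_positive_definite A"
  shows "smallest_eigenvalue A > 0"
proof -
  have "is_eigenvalue A (smallest_eigenvalue A)"
    using assms by (intro smallest_eigenvalue_symmetric) (auto simp: symmetric_positive_definite_def)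
  then obtain v where v: "v \<noteq> 0" "A *v v = smallest_eigenvalue A *\<^sub>R v"
    by (auto simp: is_eigenvalue_def)
  have "0 < smallest_eigenvalue A * (v \<bullet> v)"
    using assms v unfolding symmetric_positive_definite_def by (metis inner_scaleR_right)
  moreover have "v \<bullet> v > 0" using v(1) by simp
  ultimately show ?thesis by (metis zero_less_mult_pos2)
qed

lemma positive_definite_matrix_inv:
  assumes "symmetric_positive_definite A"
  shows "A *v (matrix_inv A *v x) = x"
proof -
  have "\<forall>x. A *v x = 0 \<longrightarrow> x = 0"
    using assms unfolding symmetric_positive_definite_def by (metis inner_zero_right less_irrefl)
  hence "invertible A"
    using matrix_left_invertible_ker invertible_left_inverse by blast
  hence "A ** matrix_inv A = mat 1"
    unfolding invertible_def matrix_inv_def by (metis (mono_tags, lifting) someI_ex)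
  thus ?thesis by (simp add: matrix_vector_mul_assoc)
qed

text \<open>
  This is \<open>p \<bullet> A\<inverse> p \<le> (p \<bullet> p) / \<lambda>\<close> with \<open>p = A w\<close>. The Rayleigh bound and Cauchy-Schwarz give
  \<open>\<lambda> \<bar>w\<bar> \<le> \<bar>A w\<bar>\<close>; a second use of Cauchy-Schwarz then bounds the form.
\<close>
lemma inverse_form_le:
  fixes A :: "real^'n^'n"
  assumes spd: "symmetric_positive_definite A"
  shows "w \<bullet> (A *v w) \<le> ((A *v w) \<bullet> (A *v w)) / smallest_eigenvalue A"
proof (cases "w = 0")
  case False
  define l where "l = smallest_eigenvalue A"
  have l: "l > 0" using smallest_eigenvalue_pos[OF spd] by (simp add: l_def)
  have CS: "w \<bullet> (A *v w) \<le> norm w * norm (A *v w)" by (rule norm_cauchy_schwarz)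
  have "l * (norm w * norm w) \<le> w \<bullet> (A *v w)"
    using smallest_eigenvalue_symmetric(2)[of A w] spd
    by (simp add: l_def symmetric_positive_definite_def dot_square_norm power2_eq_square)
  hence "norm w * (l * norm w) \<le> norm w * norm (A *v w)" using CS by (simp add: ac_simps)
  hence "l * norm w \<le> norm (A *v w)" using False by simp
  hence "l * norm w * norm (A *v w) \<le> norm (A *v w) * norm (A *v w)"
    by (intro mult_right_mono) auto
  moreover have "l * (w \<bullet> (A *v w)) \<le> l * norm w * norm (A *v w)"
    using CS l by simp
  ultimately have "l * (w \<bullet> (A *v w)) \<le> (A *v w) \<bullet> (A *v w)"
    by (simp add: dot_square_norm power2_eq_square)
  thus ?thesis using l by (simp add: l_def field_simps)
qed simp

lemma quadratic_loss_nonneg: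
  assumes "symmetric_positive_definite A"
  shows "0 \<le> quadratic_loss A \<theta> a"
  using assms unfolding symmetric_positive_definite_def quadratic_loss_def
  by (cases "a - \<theta> = 0") (auto intro: less_imp_le)

text \<open>
  Subtracting \<open>w = A\<inverse> p\<close> rather than \<open>p\<close> makes the cross term an unweighted inner product
  with \<open>p\<close>, to which the coordinatewise identity \<open>poisson_vec_shift\<close> below applies.
\<close>
lemma quadratic_loss_correction:
  fixes A :: "real^'n^'n"
  assumes sym: "transpose A = A" and w: "A *v w = p"
  shows "quadratic_loss A \<theta> (a - w) = quadratic_loss A \<theta> a - 2 * ((a - \<theta>) \<bullet> p) + w \<bullet> p"
proof -
  have "w \<bullet> (A *v (a - \<theta>)) = (a - \<theta>) \<bullet> p"
    using symmetric_dot_swap[OF sym, of w "a - \<theta>"] w by (simp add: inner_commute)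
  moreover have "a - w - \<theta> = (a - \<theta>) - w" by simp
  ultimately show ?thesis unfolding quadratic_loss_def
    by (simp add: w matrix_vector_mult_diff_distrib inner_diff_left inner_diff_right del: diff_diff_eq)
qed

section \<open>Independent Poisson counts\<close>

lemma integrable_poisson_square:
  assumes "r > 0"
  shows "integrable (poisson_pmf r) (\<lambda>k. (real k)\<^sup>2)"
proof -
  have "summable (\<lambda>k. r ^ k / fact k * exp (- r) * (real k)\<^sup>2)"
  proof (rule summable_comparison_test')
    show "summable (\<lambda>k. exp (- r) * (inverse (fact k) * (4 * r) ^ k))"
      by (intro summable_mult summable_exp)
    fix k :: nat assume "k \<ge> 0"
    \<comment> \<open>Since \<open>k\<^sup>2 \<le> 4 ^ k\<close>, the exponential series at \<open>4 * r\<close> is a majorant.\<close>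
    have "real k \<le> 2 ^ k" by (simp add: less_imp_le of_nat_less_two_power)
    hence "(real k)\<^sup>2 \<le> (2 ^ k)\<^sup>2" by (intro power_mono) auto
    also have "\<dots> = (4::real) ^ k" by (simp add: power2_eq_square flip: power_mult_distrib)
    finally have "r ^ k / fact k * exp (- r) * (real k)\<^sup>2 \<le> r ^ k / fact k * exp (- r) * 4 ^ k"
      using assms by (intro mult_left_mono) auto
    thus "norm (r ^ k / fact k * exp (- r) * (real k)\<^sup>2) \<le> exp (- r) * (inverse (fact k) * (4 * r) ^ k)"
      using assms by (simp add: power_mult_distrib field_simps)
  qed
  thus ?thesis
    unfolding measure_pmf_eq_density using assms
    by (subst integrable_density) (auto simp: integrable_count_space_nat_iff summable_norm_cancel)
qed

text \<open>
  A single growth criterion serves for all the expectations below: the loss of the usual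
  estimator grows quadratically, the cross terms at most linearly, and the rest is bounded.
\<close>
lemma integrable_poisson_vec_quadratic_growth:
  fixes f :: "('n::finite \<Rightarrow> nat) \<Rightarrow> real"
  assumes \<theta>: "\<theta> \<in> parameter_space"
    and f: "\<And>y. \<bar>f y\<bar> \<le> C * (1 + (\<Sum>i\<in>UNIV. (real (y i))\<^sup>2))"
  shows "integrable (poisson_vec_pmf \<theta>) f"
proof -
  have "integrable (poisson_vec_pmf \<theta>) (\<lambda>y. (real (y i))\<^sup>2)" for i
  proof -
    have "integrable (map_pmf (\<lambda>y. y i) (poisson_vec_pmf \<theta>)) (\<lambda>k. (real k)\<^sup>2)"
      unfolding poisson_vec_pmf_def using \<theta>
      by (simp add: Pi_pmf_component integrable_poisson_square parameter_space_def del: integrable_map_pmf_eq)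
    thus ?thesis by simp
  qed
  hence "integrable (poisson_vec_pmf \<theta>) (\<lambda>y. C * (1 + (\<Sum>i\<in>UNIV. (real (y i))\<^sup>2)))"
    by (intro integrable_mult_right Bochner_Integration.integrable_add Bochner_Integration.integrable_sum) auto
  thus ?thesis
    by (rule Bochner_Integration.integrable_bound) (auto intro!: AE_I2 order_trans[OF f])
qed

lemma pmf_poisson_vec:
  assumes "\<theta> \<in> parameter_space"
  shows "pmf (poisson_vec_pmf \<theta>) y = (\<Prod>j\<in>UNIV. (\<theta> $ j) ^ y j / fact (y j) * exp (- (\<theta> $ j)))"
  using assms by (simp add: poisson_vec_pmf_def pmf_Pi parameter_space_def)

text \<open>
  The discrete analogue of Stein's identity. Raising the \<open>i\<close>-th count by one turns the weight
  \<open>\<theta>\<^sub>i\<^sup>k / k!\<close> into itself times \<open>\<theta>\<^sub>i / (k + 1)\<close>, so summation over the shifted lattice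
  trades the factor \<open>\<theta>\<^sub>i\<close> for the count. The part of the lattice with \<open>y i = 0\<close>, which the shift
  misses and on which \<open>y i - 1\<close> is truncated, carries the factor \<open>y i = 0\<close>. Reindexing
  along an injection preserves summability, so if one side diverges, both have the default value \<open>0\<close>.
\<close>
lemma poisson_vec_shift:
  fixes f :: "('n::finite \<Rightarrow> nat) \<Rightarrow> real"
  assumes \<theta>: "\<theta> \<in> parameter_space"
  shows "measure_pmf.expectation (poisson_vec_pmf \<theta>) (\<lambda>y. \<theta> $ i * f y) =
         measure_pmf.expectation (poisson_vec_pmf \<theta>) (\<lambda>y. real (y i) * f (y(i := y i - 1)))"
proof -
  define g where "g = (\<lambda>y::'n \<Rightarrow> nat. y(i := Suc (y i)))"
  let ?p = "pmf (poisson_vec_pmf \<theta>)"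
  let ?h = "\<lambda>y. ?p y * (real (y i) * f (y(i := y i - 1)))"
  have down: "(g y)(i := g y i - 1) = y" for y by (simp add: g_def)
  hence inj: "inj g" by (metis injI)
  have range: "y \<in> range g" if "y i \<noteq> 0" for y
    using that by (intro image_eqI[of _ _ "y(i := y i - 1)"]) (auto simp: g_def)
  have step: "?p (g y) * real (Suc (y i)) = ?p y * \<theta> $ i" for y
  proof -
    have "(\<Prod>j\<in>UNIV - {i}. (\<theta> $ j) ^ g y j / fact (g y j) * exp (- (\<theta> $ j)))
        = (\<Prod>j\<in>UNIV - {i}. (\<theta> $ j) ^ y j / fact (y j) * exp (- (\<theta> $ j)))"
      by (intro prod.cong) (auto simp: g_def)
    thus ?thesis
      by (simp add: pmf_poisson_vec[OF \<theta>] prod.remove[of UNIV i] g_def field_simps del: of_nat_Suc)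
  qed
  have "infsetsum ?h UNIV = infsetsum ?h (range g)"
    using range by (intro infsetsum_cong_neutral) auto
  also have "\<dots> = infsetsum (\<lambda>y. ?h (g y)) UNIV"
    using inj by (rule infsetsum_reindex)
  also have "(\<lambda>y. ?h (g y)) = (\<lambda>y. ?p y * (\<theta> $ i * f y))"
  proof
    fix y
    have "?h (g y) = (?p (g y) * real (Suc (y i))) * f y"
      unfolding down by (simp add: g_def)
    thus "?h (g y) = ?p y * (\<theta> $ i * f y)" unfolding step by simp
  qed
  finally show ?thesis unfolding pmf_expectation_eq_infsetsum by (rule sym)
qed

section \<open>The pointwise inequality\<close>

lemma harm_le_harm_mult: "harm k \<le> harm k * (harm (k + 1) :: real)"
proof -
  have "harm 1 \<le> (harm (k + 1) :: real)" by (rule harm_mono) simp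
  thus ?thesis using mult_left_mono[of 1 "harm (k + 1)" "harm k :: real"]
    by (simp add: harm_expand harm_nonneg)
qed

text \<open>
  With \<open>t = T(y\<^sub>i)\<close>, \<open>t' = T(y\<^sub>i - 1)\<close>, \<open>x = t' t\<close> and \<open>R\<close> the part of \<open>B\<close> that comes from the other
  coordinates, \<open>B(y) = R + z\<close> and \<open>B(y - e\<^sub>i) = R + x\<close>. The choice of \<open>B\<close> makes the telescoping
  exact: \<open>y\<^sub>i (z - x) = t (2 - 1 / (y\<^sub>i + 1))\<close>. The loss caused by the change of denominator is
  therefore proportional to \<open>x / (R + x)\<close>. Because \<open>u / (R + u)\<close> increases with \<open>u\<close>, this is at
  most \<open>z / (R + z) = z / B(y)\<close>, which restores a denominator that all coordinates share, and the
  resulting bounds can be summed.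
\<close>
lemma psi_decrement_lower_bound:
  fixes y :: "'n::finite \<Rightarrow> nat" and i :: 'n
  assumes mono: "nondecreasing_each d" and nonneg: "\<And>y. 0 \<le> d y"
  defines "z \<equiv> harm (y i) * harm (y i + 1)"
  shows "d y / B_fun y * (of_bool (y i \<ge> 1) - (2 - 1 / (real (y i) + 1)) * z / B_fun y)
    \<le> real (y i) * (psi d y $ i - psi d (y(i := y i - 1)) $ i)"
proof (cases "y i")
  case 0
  thus ?thesis by (simp add: z_def harm_expand)
next
  case (Suc k)
  define y' where "y' = y(i := k)"
  define t t' R where "t = (harm (Suc k) :: real)" and "t' = (harm k :: real)"
    and "R = (\<Sum>j\<in>UNIV - {i}. harm (y j) * harm (y j + 1) :: real)"
  define c where "c = 2 - 1 / (real (Suc k) + 1)"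
  define x where "x = t' * t"
  have t: "t > 0" "t' \<ge> 0" "t = t' + 1 / real (Suc k)"
    using harm_pos[of "Suc k", where 'a = real]
    by (simp_all add: t_def t'_def harm_nonneg harm_Suc inverse_eq_divide)
  have R: "R \<ge> 0" unfolding R_def by (intro sum_nonneg mult_nonneg_nonneg harm_nonneg)
  have z: "z = t * (t + 1 / (real (Suc k) + 1))"
    by (simp add: z_def Suc t_def harm_Suc inverse_eq_divide ac_simps)
  have x: "x \<ge> 0" using t by (simp add: x_def)
  have zx: "real (Suc k) * (z - x) = t * c"
  proof -
    have "z - x = t * (1 / real (Suc k) + 1 / (real (Suc k) + 1))"
      unfolding z x_def by (subst (2) t(3)) (simp add: algebra_simps)
    moreover have "real (Suc k) * (1 / real (Suc k) + 1 / (real (Suc k) + 1)) = c"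
    proof -
      have "a * (1 / a + 1 / (a + 1)) = 2 - 1 / (a + 1)" if "a > 0" for a :: real
        using that by (simp add: divide_simps)
      from this[of "real (Suc k)"] show ?thesis unfolding c_def by (simp del: of_nat_Suc)
    qed
    ultimately show ?thesis by (metis mult.left_commute)
  qed
  have tzx: "t' * (real (Suc k) * (z - x)) = c * x"
    unfolding zx by (simp add: x_def)
  have "x \<le> z" unfolding x_def z using t
    by (subst mult.commute, intro mult_left_mono) (auto intro: add_nonneg_nonneg)
  have zpos: "z > 0" unfolding z using t by (intro mult_pos_pos add_pos_pos) auto
  have B: "B_fun y = R + z"
    unfolding B_fun_def R_def z_def by (subst sum.remove[of UNIV i]) auto
  have "B_fun y' = (\<Sum>j\<in>UNIV - {i}. harm (y' j) * harm (y' j + 1)) + x"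
    unfolding B_fun_def x_def t_def t'_def by (subst sum.remove[of UNIV i]) (auto simp: y'_def)
  also have "(\<Sum>j\<in>UNIV - {i}. harm (y' j) * harm (y' j + 1) :: real) = R"
    unfolding R_def by (intro sum.cong) (auto simp: y'_def)
  finally have B': "B_fun y' = R + x" .
  have c0: "c \<ge> 0" by (simp add: c_def field_simps)
  have dd: "d y' \<le> d y"
  proof -
    have "y'(i := y i) = y" by (simp add: y'_def)
    thus ?thesis
      using mono[unfolded nondecreasing_each_def, rule_format, of y' i "y i"] by (simp add: y'_def Suc)
  qed
  have "1 / (R + z) * (1 - c * z / (R + z)) \<le> real (Suc k) * (t / (R + z) - t' / (R + x))"
  \<comment> \<open>If \<open>t' = 0\<close>, then \<open>y i = 1\<close> and \<open>R + x\<close> may be zero, so the quotients by it are avoided.\<close>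
  proof (cases "t' = 0")
    case True
    hence "real (Suc k) * t = 1" using t(3) by (simp del: of_nat_Suc)
    moreover have "1 / (R + z) * (1 - c * z / (R + z)) \<le> 1 / (R + z) * 1"
      using R c0 zpos by (intro mult_left_mono) auto
    ultimately show ?thesis using True by simp
  next
    case False
    hence xpos: "x > 0" using t by (simp add: x_def)
    have pos: "R + z > 0" "R + x > 0" using R zpos xpos by auto
    have "x * (R + z) \<le> z * (R + x)" using \<open>x \<le> z\<close> R by (simp add: algebra_simps mult_left_mono)
    hence "x / (R + x) \<le> z / (R + z)" using pos by (simp add: field_simps)
    hence "c * x / (R + x) \<le> c * z / (R + z)" using c0 by (metis mult_left_mono times_divide_eq_right)
    hence "1 / (R + z) * (1 - c * z / (R + z)) \<le> 1 / (R + z) * (1 - c * x / (R + x))"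
      using pos by (intro mult_left_mono) auto
    also have "\<dots> = 1 / (R + z) - t' * (real (Suc k) * (z - x)) / ((R + z) * (R + x))"
      unfolding tzx by (simp add: right_diff_distrib)
    also have "\<dots> = real (Suc k) * (t - t') / (R + z) - t' * (real (Suc k) * (z - x)) / ((R + z) * (R + x))"
      using t(3) by (simp del: of_nat_Suc)
    also have "\<dots> = real (Suc k) * (t / (R + z) - t' / (R + x))"
      using pos by (simp add: divide_simps del: of_nat_Suc) algebra
    finally show ?thesis .
  qed
  hence "d y * (1 / (R + z) * (1 - c * z / (R + z))) \<le> d y * (real (Suc k) * (t / (R + z) - t' / (R + x)))"
    using nonneg by (intro mult_left_mono) auto
  also have "\<dots> = real (Suc k) * (d y / (R + z) * t - d y / (R + x) * t')"
    by (simp add: algebra_simps)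
  also have "\<dots> \<le> real (Suc k) * (d y / (R + z) * t - d y' / (R + x) * t')"
    using dd t R x by (intro mult_left_mono diff_left_mono mult_right_mono divide_right_mono) auto
  finally show ?thesis
    by (simp add: psi_def B Suc B'[unfolded y'_def] y'_def t_def[symmetric] t'_def[symmetric] c_def ac_simps)
qed

text \<open>
  The summed decrements are at least \<open>(d/B) (N - q/B)\<close>, and if \<open>d(y) > 0\<close> then
  \<open>q < 2 B\<close>, because each factor \<open>2 - 1 / (y\<^sub>i + 1)\<close> is below \<open>2\<close> and some \<open>z\<^sub>i\<close> is positive. This strict loss of less than
  two coordinates is where the constant \<open>2\<close> in \<open>N - 2\<close>, and hence the condition \<open>p \<ge> 3\<close>, comes from.
\<close>
lemma psi_correction_inequality:
  fixes y :: "'n::finite \<Rightarrow> nat"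
  assumes mono: "nondecreasing_each d" and nonneg: "\<And>y. 0 \<le> d y"
    and l: "l > 0" and upper: "d y \<le> 2 * l * max (real (num_positive y) - 2) 0"
  defines "S \<equiv> \<Sum>i\<in>UNIV. real (y i) * (psi d y $ i - psi d (y(i := y i - 1)) $ i)"
  shows "(psi d y \<bullet> psi d y) / l \<le> 2 * S"
    and "0 < d y \<Longrightarrow> (psi d y \<bullet> psi d y) / l < 2 * S"
proof -
  define b where "b = B_fun y"
  define z where "z i = (harm (y i) * harm (y i + 1) :: real)" for i
  define q where "q = (\<Sum>i\<in>UNIV. (2 - 1 / (real (y i) + 1)) * z i)"
  have z0: "z i \<ge> 0" for i by (simp add: z_def harm_nonneg)
  have b: "b = (\<Sum>i\<in>UNIV. z i)" by (simp add: b_def B_fun_def z_def)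
  have "(\<Sum>i\<in>UNIV. d y / b * (of_bool (y i \<ge> 1) - (2 - 1 / (real (y i) + 1)) * z i / b)) \<le> S"
    unfolding S_def b_def z_def by (intro sum_mono psi_decrement_lower_bound mono nonneg)
  also have "(\<Sum>i\<in>UNIV. d y / b * (of_bool (y i \<ge> 1) - (2 - 1 / (real (y i) + 1)) * z i / b))
      = d y / b * (real (num_positive y) - q / b)"
    unfolding num_positive_def q_def sum_divide_distrib of_nat_sum of_nat_of_bool
    by (simp only: sum_subtractf sum_distrib_left right_diff_distrib)
  finally have S: "d y / b * (real (num_positive y) - q / b) \<le> S" .
  show strict: "(psi d y \<bullet> psi d y) / l < 2 * S" if d: "0 < d y"
  proof -
    have N: "real (num_positive y) > 2" 
      using upper d l by (cases "real (num_positive y) > 2") (auto simp: max_def)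
    have "\<exists>i. y i \<ge> 1"
      using N by (rule_tac ccontr) (simp add: num_positive_def)
    then obtain i where i: "y i \<ge> 1" by blast
    hence zi: "z i > 0" by (simp add: z_def harm_pos)
    have bpos: "b > 0" unfolding b using z0 zi by (intro sum_pos2[of _ i]) auto
    have "q < (\<Sum>i\<in>UNIV. 2 * z i)"
      unfolding q_def using z0 zi
      by (intro sum_strict_mono_ex1 ballI bexI[of _ i] mult_right_mono mult_strict_right_mono) auto
    hence "q < 2 * b" by (simp add: b sum_distrib_left)
    hence q: "q / b < 2" using bpos by (simp add: field_simps)
    have "(\<Sum>i\<in>UNIV. (harm (y i))\<^sup>2) \<le> b"
      unfolding b z_def power2_eq_square
      by (intro sum_mono mult_left_mono harm_mono harm_nonneg) auto
    hence "(d y / b)\<^sup>2 * (\<Sum>i\<in>UNIV. (harm (y i))\<^sup>2) \<le> (d y / b)\<^sup>2 * b"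
      by (intro mult_left_mono) auto
    moreover have "psi d y \<bullet> psi d y = (d y / b)\<^sup>2 * (\<Sum>i\<in>UNIV. (harm (y i))\<^sup>2)"
      unfolding inner_vec_def psi_def b_def sum_distrib_left
      by (intro sum.cong) (simp_all add: power2_eq_square)
    ultimately have "(psi d y \<bullet> psi d y) / l \<le> (d y / b)\<^sup>2 * b / l"
      using l by (simp add: divide_right_mono)
    also have "\<dots> = d y / b * (d y / l)" using bpos by (simp add: power2_eq_square)
    also have "\<dots> \<le> d y / b * (2 * (real (num_positive y) - 2))"
      using upper l N d bpos by (intro mult_left_mono) (auto simp: max_def field_simps)
    also have "\<dots> < d y / b * (2 * (real (num_positive y) - q / b))"
      using d bpos q by (intro mult_strict_left_mono) auto
    also have "\<dots> = 2 * (d y / b * (real (num_positive y) - q / b))" by simp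
    also have "\<dots> \<le> 2 * S" using S by (intro mult_left_mono) auto
    finally show ?thesis .
  qed
  show "(psi d y \<bullet> psi d y) / l \<le> 2 * S"
  proof (cases "d y = 0")
    case True
    hence "psi d y = 0" by (simp add: psi_def vec_eq_iff)
    thus ?thesis using S True by simp
  next
    case False
    thus ?thesis using strict nonneg[of y] by (simp add: less_imp_le)
  qed
qed

text \<open>
  \<open>T(y\<^sub>i) \<le> B(y)\<close>, so \<open>psi d\<close> inherits the bound on \<open>d\<close>; the boundedness makes the expectations
  in the risk comparison finite.
\<close>
lemma psi_bounds:
  assumes "0 \<le> d y"
  shows "0 \<le> psi d y $ i" "psi d y $ i \<le> d y"
proof -
  have B: "harm (y i) \<le> B_fun y"
  proof -
    have "harm (y i) \<le> harm (y i) * (harm (y i + 1) :: real)" by (rule harm_le_harm_mult)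
    also have "\<dots> \<le> B_fun y"
      unfolding B_fun_def by (rule member_le_sum) (auto simp: harm_nonneg)
    finally show ?thesis .
  qed
  have B0: "B_fun y \<ge> 0" using B harm_nonneg[of "y i", where 'a = real] by linarith
  show "0 \<le> psi d y $ i" using assms B0 by (simp add: psi_def harm_nonneg)
  show "psi d y $ i \<le> d y"
  proof (cases "B_fun y = 0")
    case False
    have "d y * harm (y i) \<le> d y * B_fun y" using B assms by (rule mult_left_mono)
    thus ?thesis using B0 False by (simp add: psi_def field_simps)
  qed (use assms in \<open>simp add: psi_def\<close>)
qed

section \<open>Domination\<close>

lemma le_one_plus_sum_squares:
  fixes y :: "'n::finite \<Rightarrow> nat"
  shows "real (y i) \<le> 1 + (\<Sum>j\<in>UNIV. (real (y j))\<^sup>2)"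
proof -
  have "real (y i) \<le> (real (y i))\<^sup>2"
    by (metis of_nat_le_iff of_nat_power power2_nat_le_imp_le order_refl le_square power2_eq_square)
  also have "\<dots> \<le> (\<Sum>j\<in>UNIV. (real (y j))\<^sup>2)" by (rule member_le_sum) auto
  finally show ?thesis by simp
qed

lemma integrable_usual_loss:
  fixes A :: "real^'n^'n"
  assumes \<theta>: "\<theta> \<in> parameter_space"
  shows "integrable (poisson_vec_pmf \<theta>) (\<lambda>y. quadratic_loss A \<theta> (usual_estimator y))"
proof -
  obtain K where K: "\<And>x. norm (A *v x) \<le> norm x * K" "0 < K"
    using bounded_linear.pos_bounded[OF matrix_vector_mul_bounded_linear[of A]] by blast
  show ?thesis
  proof (rule integrable_poisson_vec_quadratic_growth[OF \<theta>])
    fix y :: "'n \<Rightarrow> nat"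
    let ?Y = "usual_estimator y" and ?s = "\<Sum>i\<in>UNIV. (real (y i))\<^sup>2"
    have s: "?Y \<bullet> ?Y = ?s"
      by (simp add: inner_vec_def usual_estimator_def power2_eq_square)
    have "\<bar>quadratic_loss A \<theta> ?Y\<bar> \<le> norm (?Y - \<theta>) * norm (A *v (?Y - \<theta>))"
      unfolding quadratic_loss_def by (rule Cauchy_Schwarz_ineq2)
    also have "\<dots> \<le> norm (?Y - \<theta>) * (norm (?Y - \<theta>) * K)"
      using K(1) by (intro mult_left_mono) auto
    also have "\<dots> = K * (norm (?Y - \<theta>))\<^sup>2" by (simp add: power2_eq_square)
    also have "(norm (?Y - \<theta>))\<^sup>2 \<le> 2 * (norm ?Y)\<^sup>2 + 2 * (norm \<theta>)\<^sup>2"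
    proof -
      have "(norm (?Y - \<theta>))\<^sup>2 \<le> (norm ?Y + norm \<theta>)\<^sup>2"
        by (intro power_mono norm_triangle_ineq4) auto
      also have "\<dots> \<le> 2 * (norm ?Y)\<^sup>2 + 2 * (norm \<theta>)\<^sup>2"
        using sum_squares_bound[of "norm ?Y" "norm \<theta>"] by (simp add: power2_sum)
      finally show ?thesis .
    qed
    also have "2 * (norm ?Y)\<^sup>2 + 2 * (norm \<theta>)\<^sup>2 \<le> (2 + 2 * (norm \<theta>)\<^sup>2) * (1 + ?s)"
      unfolding s[symmetric] dot_square_norm by (simp add: algebra_simps)
    finally show "\<bar>quadratic_loss A \<theta> ?Y\<bar> \<le> (K * (2 + 2 * (norm \<theta>)\<^sup>2)) * (1 + ?s)"
      using K(2) by simp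
  qed
qed

text \<open>
  All the terms are integrable, so the risks are real expectations and can be subtracted. The
  losses \<open>U\<close> and \<open>V\<close> of the two estimators satisfy \<open>E V = E (U - G)\<close>, where \<open>G\<close> comes from
  \<open>U - V\<close> when \<open>poisson_vec_shift\<close> replaces each \<open>\<theta> $ i * f i\<close>. Unlike \<open>U - V\<close> itself, \<open>G\<close> is
  nonnegative at every point, and it is positive at \<open>y0\<close>.
\<close>
lemma risk_less:
  fixes A :: "real^'n^'n"
  assumes spd: "symmetric_positive_definite A" and \<theta>: "\<theta> \<in> parameter_space"
    and mono: "nondecreasing_each d" and nonneg: "\<And>y. 0 \<le> d y"
    and upper: "\<And>y. d y \<le> 2 * smallest_eigenvalue A * max (real (num_positive y) - 2) 0"
    and ne: "d y0 \<noteq> 0"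
  shows "risk (quadratic_loss A) (\<lambda>y. usual_estimator y - matrix_inv A *v psi d y) \<theta>
    < risk (quadratic_loss A) usual_estimator \<theta>"
proof -
  define l where "l = smallest_eigenvalue A"
  define w where "w y = matrix_inv A *v psi d y" for y
  define f where "f i y = psi d y $ i" for i y
  define f' where "f' i y = f i (y(i := y i - 1))" for i and y :: "'n \<Rightarrow> nat"
  define U where "U y = quadratic_loss A \<theta> (usual_estimator y)" for y
  define V where "V y = quadratic_loss A \<theta> (usual_estimator y - w y)" for y
  define c where "c y = w y \<bullet> psi d y" for y
  define G where "G y = 2 * (\<Sum>i\<in>UNIV. real (y i) * f i y - real (y i) * f' i y) - c y" for y
  define D where "D = 2 * l * real CARD('n)"
  let ?P = "poisson_vec_pmf \<theta>"
  note growth = integrable_poisson_vec_quadratic_growth[OF \<theta>]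
  have sym: "transpose A = A" using spd by (simp add: symmetric_positive_definite_def)
  have l: "l > 0" using smallest_eigenvalue_pos[OF spd] by (simp add: l_def)
  have D0: "D \<ge> 0" using l by (simp add: D_def)
  have dD: "d y \<le> D" for y
  proof -
    have "real (num_positive y) \<le> real CARD('n)"
      unfolding num_positive_def of_nat_le_iff
      using sum_bounded_above[of UNIV "\<lambda>i. of_bool (y i \<ge> 1) :: nat" 1] by simp
    hence "max (real (num_positive y) - 2) 0 \<le> real CARD('n)" by simp
    hence "2 * l * max (real (num_positive y) - 2) 0 \<le> D"
      unfolding D_def using l by (intro mult_left_mono) auto
    thus ?thesis using upper[of y] by (simp add: l_def)
  qed
  have f: "0 \<le> f i y" "f i y \<le> D" for i y
    using psi_bounds[of d y i] nonneg[of y] dD[of y] by (auto simp: f_def)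
  have yb: "\<bar>real (y i) * a\<bar> \<le> D * (1 + (\<Sum>j\<in>UNIV. (real (y j))\<^sup>2))"
    if "0 \<le> a" "a \<le> D" for a i and y :: "'n \<Rightarrow> nat"
  proof -
    have "real (y i) * a \<le> (1 + (\<Sum>j\<in>UNIV. (real (y j))\<^sup>2)) * D"
      using that by (intro mult_mono le_one_plus_sum_squares) (auto intro!: add_nonneg_nonneg sum_nonneg)
    thus ?thesis using that by (simp add: mult.commute)
  qed
  have const: "a \<le> a * (1 + (\<Sum>j\<in>UNIV. (real (y j))\<^sup>2))" if "0 \<le> a" for a and y :: "'n \<Rightarrow> nat"
    using that mult_nonneg_nonneg[OF that, of "\<Sum>j\<in>UNIV. (real (y j))\<^sup>2"]
    by (simp add: distrib_left sum_nonneg)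
  have Aw: "A *v w y = psi d y" for y by (simp add: w_def positive_definite_matrix_inv[OF spd])
  have c: "c y \<le> (psi d y \<bullet> psi d y) / l" for y
    using inverse_form_le[OF spd, of "w y"] by (simp add: Aw c_def l_def)
  have c0: "0 \<le> c y" for y
    using quadratic_loss_nonneg[OF spd, of 0 "w y"] by (simp add: quadratic_loss_def Aw c_def)
  have "psi d y \<bullet> psi d y \<le> real CARD('n) * (D * D)" for y
    unfolding inner_vec_def using f[of _ y, unfolded f_def]
    by (intro sum_bounded_above[where A = UNIV, simplified]) (auto intro!: mult_mono D0)
  hence cD: "c y \<le> real CARD('n) * (D * D) / l" for y
    using c[of y] l by (meson divide_right_mono less_imp_le order_trans)
  have int_f: "integrable ?P (f i)" for i
    by (rule growth[of _ D]) (use f const[OF D0] in \<open>auto intro: order_trans[OF f(2)]\<close>)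
  have int_yf: "integrable ?P (\<lambda>y. real (y i) * f i y)" for i
    by (rule growth[of _ D]) (intro yb f)
  have int_yf': "integrable ?P (\<lambda>y. real (y i) * f' i y)" for i
    by (rule growth[of _ D]) (unfold f'_def, intro yb f)
  have int_c: "integrable ?P c"
  proof (rule growth[of _ "real CARD('n) * (D * D) / l"])
    fix y
    have "real CARD('n) * (D * D) / l \<ge> 0" using l by simp
    from const[OF this, of y] show "\<bar>c y\<bar> \<le> real CARD('n) * (D * D) / l * (1 + (\<Sum>i\<in>UNIV. (real (y i))\<^sup>2))"
      using c0[of y] cD[of y] by linarith
  qed
  have int_U: "integrable ?P U" unfolding U_def by (rule integrable_usual_loss[OF \<theta>])
  have int_G: "integrable ?P G" unfolding G_def
    by (intro Bochner_Integration.integrable_diff integrable_mult_right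
        Bochner_Integration.integrable_sum int_yf int_yf' int_c)
  have V: "V = (\<lambda>y. U y - 2 * (\<Sum>i\<in>UNIV. real (y i) * f i y - \<theta> $ i * f i y) + c y)"
    unfolding V_def U_def c_def quadratic_loss_correction[OF sym Aw]
    by (simp add: inner_vec_def usual_estimator_def f_def algebra_simps)
  note ints = Bochner_Integration.integrable_diff Bochner_Integration.integrable_add
    Bochner_Integration.integrable_sum integrable_mult_right int_U int_c int_f int_yf int_yf'
  have int_V: "integrable ?P V" unfolding V by (intro ints)
  have shift: "\<theta> $ i * measure_pmf.expectation ?P (f i)
      = measure_pmf.expectation ?P (\<lambda>y. real (y i) * f' i y)" for i
    using poisson_vec_shift[OF \<theta>, of i "f i"] by (simp add: f'_def)
  have EV: "measure_pmf.expectation ?P V = measure_pmf.expectation ?P (\<lambda>y. U y - G y)"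
    by (simp add: V G_def ints shift)
  have "G y \<ge> 0" for y
    using psi_correction_inequality(1)[OF mono nonneg l upper[folded l_def], of y] c[of y]
    by (simp add: G_def f'_def f_def right_diff_distrib)
  moreover have "G y0 > 0"
    using psi_correction_inequality(2)[OF mono nonneg l upper[folded l_def], of y0] c[of y0]
      nonneg[of y0] ne by (simp add: G_def f'_def f_def right_diff_distrib)
  moreover have "emeasure ?P {y0} \<noteq> 0"
  proof -
    have "pmf ?P y0 > 0"
      unfolding pmf_poisson_vec[OF \<theta>] using \<theta> by (intro prod_pos) (auto simp: parameter_space_def)
    thus ?thesis by (simp add: emeasure_pmf_single)
  qed
  ultimately have "measure_pmf.expectation ?P (\<lambda>y. U y - G y) < measure_pmf.expectation ?P U"
    by (intro measure_pmf.integral_less_AE[where A = "{y0}"] Bochner_Integration.integrable_diff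
        int_U int_G AE_I2) auto
  hence less: "measure_pmf.expectation ?P V < measure_pmf.expectation ?P U" by (simp add: EV)
  have V0: "0 \<le> V y" and U0: "0 \<le> U y" for y
    unfolding U_def V_def by (rule quadratic_loss_nonneg[OF spd])+
  have "(\<integral>\<^sup>+ y. ennreal (V y) \<partial>?P) < (\<integral>\<^sup>+ y. ennreal (U y) \<partial>?P)"
    using less V0 U0 int_V int_U
    by (simp add: nn_integral_eq_integral ennreal_less_iff Bochner_Integration.integral_nonneg)
  thus ?thesis by (simp add: risk_def U_def V_def w_def)
qed

lemma num_positive_mono:
  fixes y :: "'n::finite \<Rightarrow> nat"
  assumes "y i \<le> k"
  shows "num_positive y \<le> num_positive (y(i := k))"
  unfolding num_positive_def using assms by (intro sum_mono) auto

theorem theorem1: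
  fixes A :: "real^'n^'n"
  assumes "CARD('n) \<ge> 3"
    and "symmetric_positive_definite A"
  shows "inadmissible (quadratic_loss A) usual_estimator \<and>
    (\<forall>M d. M = inverse (smallest_eigenvalue A) \<longrightarrow>
       (\<exists>y. d y \<noteq> 0) \<longrightarrow>
       nondecreasing_each d \<longrightarrow>
       (\<forall>y. 0 \<le> d y \<and> d y \<le> 2 / M * max (real (num_positive y) - 2) 0) \<longrightarrow>
       dominates (quadratic_loss A)
         (\<lambda>y. usual_estimator y - matrix_inv A *v psi d y) usual_estimator)"
proof -
  let ?l = "smallest_eigenvalue A"
  have dom: "dominates (quadratic_loss A)
      (\<lambda>y. usual_estimator y - matrix_inv A *v psi d y) usual_estimator"
    if d: "\<exists>y. d y \<noteq> 0" "nondecreasing_each d"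
      "\<And>y. 0 \<le> d y" "\<And>y. d y \<le> 2 * ?l * max (real (num_positive y) - 2) 0" for d
  proof -
    obtain y0 where "d y0 \<noteq> 0" using d(1) by blast
    note less = risk_less[OF assms(2) _ d(2-4) this]
    have "(\<chi> i. 1) \<in> (parameter_space :: (real^'n) set)" by (simp add: parameter_space_def)
    thus ?thesis unfolding dominates_def using less by (meson less_imp_le)
  qed
  define d where "d y = 2 * ?l * max (real (num_positive y) - 2) 0" for y :: "'n \<Rightarrow> nat"
  have l: "?l > 0" by (rule smallest_eigenvalue_pos[OF assms(2)])
  have "d (\<lambda>_. 1) \<noteq> 0"
    using l assms(1) by (simp add: d_def num_positive_def max_def)
  moreover have "nondecreasing_each d"
    unfolding nondecreasing_each_def d_def using l
    by (intro allI impI mult_left_mono max.mono diff_right_mono) (auto simp: num_positive_mono)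
  ultimately have "dominates (quadratic_loss A)
      (\<lambda>y. usual_estimator y - matrix_inv A *v psi d y) usual_estimator"
    using l by (intro dom) (auto simp: d_def)
  hence "inadmissible (quadratic_loss A) usual_estimator"
    unfolding inadmissible_def by blast
  thus ?thesis using dom by (auto simp: divide_inverse)
qed

end
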